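(* Let $E$ be a complex Hilbert space. If $(x_n)_{n\in\mathbb{N}}\subset B_E\setminus\{0\}$ is an interpolating sequence for $\mathcal{B}(B_E)$, then there exists $C>0$ such that $\rho_E(x_k,x_j)\ge C$ for all $k\neq j$, $k,j\in\mathbb{N}$.
   Context: $E$ is a finite or infinite dimensional complex Hilbert space, $B_E$ its open unit ball. The pseudohyperbolic distance $\rho_E(x,y)\in[0,1)$ on $B_E$ is given by $\rho_E(x,y)^2=1-\frac{(1-\|x\|^2)(1-\|y\|^2)}{|1-\langle x,y\rangle|^2}$. For holomorphic (Fréchet differentiable) $f:B_E\to\mathbb{C}$, $\nabla f(x)$ denotes the derivative $f'(x)$, and $\mathcal{R}f(x)=\langle x,\overline{\nabla f(x)}\rangle=f'(x)(x)$ is the radial derivative. The Bloch space $\mathcal{B}(B_E)$ is the set of holomorphic $f:B_E\to\mathbb{C}$ with $\sup_{x\in B_E}(1-\|x\|^2)\|\nabla f(x)\|<\infty$. A sequence $(x_n)\subset B_E\setminus\{0\}$ is interpolating for $\mathcal{B}(B_E)$ if for every bounded sequence $(a_n)$ of complex numbers there exists $f\in\mathcal{B}(B_E)$ such that $(1-\|x_n\|^2)\,\mathcal{R}f(x_n)=a_n$ for all $n$. *)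

theory Defs
  imports "HOL-Analysis.Analysis"
begin

text \<open>
  A type of class \<open>complex_hilbert_space\<close> is a complex Hilbert space of arbitrary (finite or
  infinite) dimension. The class extends \<open>banach\<close>, so completeness and the norm are the
  library's; the inner product is linear in its first argument.
\<close>

class complex_hilbert_space = banach +
  fixes scaleC :: "complex \<Rightarrow> 'a \<Rightarrow> 'a" (infixr \<open>*\<^sub>C\<close> 75)
    and cinner :: "'a \<Rightarrow> 'a \<Rightarrow> complex"
  assumes scaleC_add_right: "c *\<^sub>C (x + y) = c *\<^sub>C x + c *\<^sub>C y"
    and scaleC_add_left: "(c + d) *\<^sub>C x = c *\<^sub>C x + d *\<^sub>C x"
    and scaleC_scaleC: "c *\<^sub>C d *\<^sub>C x = (c * d) *\<^sub>C x"
    and scaleC_one: "1 *\<^sub>C x = x"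
    and scaleR_scaleC: "r *\<^sub>R x = complex_of_real r *\<^sub>C x"
    and cinner_commute: "cinner x y = cnj (cinner y x)"
    and cinner_add_left: "cinner (x + y) z = cinner x z + cinner y z"
    and cinner_scaleC_left: "cinner (c *\<^sub>C x) y = c * cinner x y"
    and cinner_self: "cinner x x = complex_of_real ((norm x)\<^sup>2)"

instantiation complex :: complex_hilbert_space
begin

definition scaleC_complex :: "complex \<Rightarrow> complex \<Rightarrow> complex"
  where "scaleC_complex c z = c * z"

definition cinner_complex :: "complex \<Rightarrow> complex \<Rightarrow> complex"
  where "cinner_complex z w = z * cnj w"

instance
  by standard
    (simp_all add: scaleC_complex_def cinner_complex_def algebra_simps scaleR_conv_of_real
      complex_norm_square del: of_real_power)

end

definition pseudohyperbolic_dist :: "'a::complex_hilbert_space \<Rightarrow> 'a \<Rightarrow> real"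
  where "pseudohyperbolic_dist x y =
    sqrt (1 - (1 - (norm x)\<^sup>2) * (1 - (norm y)\<^sup>2) / (cmod (1 - cinner x y))\<^sup>2)"

text \<open>
  The library's \<open>has_derivative\<close> is the real Frechet derivative. Complex Frechet
  differentiability requires in addition that the derivative is complex-linear.
\<close>

definition holomorphic_on_ball :: "('a::complex_hilbert_space \<Rightarrow> complex) \<Rightarrow> bool"
  where "holomorphic_on_ball f \<longleftrightarrow>
    (\<forall>x\<in>ball 0 1. \<exists>D. (f has_derivative D) (at x) \<and> (\<forall>c v. D (c *\<^sub>C v) = c * D v))"

text \<open>Only the values of \<open>f\<close> on the open unit ball matter below; \<open>onorm\<close> is the dual norm.\<close>

definition bloch_space :: "('a::complex_hilbert_space \<Rightarrow> complex) set"
  where "bloch_space = {f. holomorphic_on_ball f \<and>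
    bdd_above ((\<lambda>x. (1 - (norm x)\<^sup>2) * onorm (frechet_derivative f (at x))) ` ball 0 1)}"

definition radial_derivative :: "('a::complex_hilbert_space \<Rightarrow> complex) \<Rightarrow> 'a \<Rightarrow> complex"
  where "radial_derivative f x = frechet_derivative f (at x) x"

definition interpolating_for_bloch :: "(nat \<Rightarrow> 'a::complex_hilbert_space) \<Rightarrow> bool"
  where "interpolating_for_bloch x \<longleftrightarrow>
    (\<forall>n. x n \<in> ball 0 1 - {0}) \<and>
    (\<forall>a :: nat \<Rightarrow> complex. bounded (range a) \<longrightarrow>
      (\<exists>f\<in>bloch_space. \<forall>n.
        complex_of_real (1 - (norm (x n))\<^sup>2) * radial_derivative f (x n) = a n))"

end

theory Submission
  imports Defs "HOL-Complex_Analysis.Cauchy_Integral_Formula"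
begin

text \<open>
  Put \<open>F x = (1 - \<parallel>x\<parallel>\<^sup>2) f'(x) x\<close>. The theorem rests on two facts.

  First, for a Bloch function \<open>f\<close> the function \<open>F\<close> is Lipschitz with respect to the
  pseudohyperbolic distance \<open>\<rho>\<close> (\<open>bloch_radial_derivative_lipschitz\<close>). This is a Cauchy estimate
  on the complex line through \<open>x\<close> and \<open>y\<close>: \<open>\<rho> x y\<close> measures how large a disc of complex
  parameters \<open>\<lambda>\<close> keeps \<open>x + \<lambda> (y - x)\<close> well inside the ball, namely one of radius of order
  \<open>1 / \<rho> x y\<close>, on which \<open>1 - \<parallel>\<sqdot>\<parallel>\<^sup>2\<close> stays comparable to its value at \<open>x\<close>. A function that is
  holomorphic on complex lines and is \<open>O(1 / (1 - \<parallel>\<sqdot>\<parallel>\<^sup>2))\<close> therefore varies by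
  \<open>O(\<rho> x y / (1 - \<parallel>x\<parallel>\<^sup>2))\<close> between \<open>\<lambda> = 0\<close> and \<open>\<lambda> = 1\<close> (\<open>weighted_growth_lipschitz\<close>). The
  radial derivative is reached through the quotients \<open>(f (c x) - f x) / (c - 1)\<close>, \<open>\<bar>c\<bar> < 1\<close>:
  they are visibly holomorphic on lines, they obey the growth bound with the Bloch seminorm of
  \<open>f\<close> as constant, and they converge to \<open>f'(x) x\<close> as \<open>c\<close> tends to 1, so the Lipschitz estimate
  passes to the limit.

  Secondly, interpolating one well-chosen sequence of zeros and ones separates all pairs of
  points at once, with a constant given by that one interpolating function. Let \<open>p k\<close> be
  an index below \<open>k\<close> for which \<open>x (p k)\<close> is \<open>\<rho>\<close>-nearest to \<open>x k\<close>, and let \<open>a k = 1 - a (p k)\<close>.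
  If \<open>f\<close> interpolates \<open>a\<close> and \<open>F\<close> has Lipschitz constant \<open>L\<close>, then
  \<open>1 = \<bar>a k - a (p k)\<bar> \<le> L \<rho> (x k) (x (p k)) \<le> L \<rho> (x k) (x j)\<close> for all \<open>j < k\<close>.
\<close>

section \<open>Inner product and complex lines\<close>

lemma cinner_add_right:
  "cinner x (y + z) = cinner x y + cinner (x::'a::complex_hilbert_space) z"
  by (metis cinner_add_left cinner_commute complex_cnj_add)

lemma cinner_scaleC_right:
  "cinner x (c *\<^sub>C y) = cnj c * cinner (x::'a::complex_hilbert_space) y"
  by (metis cinner_scaleC_left cinner_commute complex_cnj_mult)

lemma norm_add_squared:
  fixes x v :: "'a::complex_hilbert_space"
  shows "(norm (x + v))\<^sup>2 = (norm x)\<^sup>2 + 2 * Re (cinner v x) + (norm v)\<^sup>2"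
proof -
  have "complex_of_real ((norm (x + v))\<^sup>2) = cinner (x + v) (x + v)"
    by (simp add: cinner_self)
  also have "\<dots> = cinner x x + (cinner v x + cinner x v) + cinner v v"
    by (simp add: cinner_add_left cinner_add_right)
  also have "cinner v x + cinner x v = complex_of_real (2 * Re (cinner v x))"
    using cinner_commute[of x v] complex_add_cnj[of "cinner v x"] by simp
  finally have "complex_of_real ((norm (x + v))\<^sup>2)
      = complex_of_real ((norm x)\<^sup>2 + 2 * Re (cinner v x) + (norm v)\<^sup>2)"
    by (simp add: cinner_self)
  then show ?thesis
    using of_real_eq_iff by blast
qed

lemma norm_scaleC: "norm (c *\<^sub>C v) = cmod c * norm (v::'a::complex_hilbert_space)"
proof -
  have "complex_of_real ((norm (c *\<^sub>C v))\<^sup>2) = c * cnj c * cinner v v"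
    unfolding cinner_self[symmetric] by (simp add: cinner_scaleC_left cinner_scaleC_right)
  also have "\<dots> = complex_of_real ((cmod c * norm v)\<^sup>2)"
    by (simp add: cinner_self complex_norm_square[symmetric] power_mult_distrib)
  finally have "(norm (c *\<^sub>C v))\<^sup>2 = (cmod c * norm v)\<^sup>2"
    using of_real_eq_iff by blast
  then show ?thesis
    by (simp add: power2_eq_iff_nonneg)
qed

lemma bounded_linear_scaleC_left: "bounded_linear (\<lambda>c. c *\<^sub>C (v::'a::complex_hilbert_space))"
proof (rule bounded_linear_intro)
  show "(r *\<^sub>R c) *\<^sub>C v = r *\<^sub>R (c *\<^sub>C v)" for r c
    by (simp add: scaleR_scaleC[of _ "c *\<^sub>C v"] scaleC_scaleC scaleR_conv_of_real)
  show "norm (c *\<^sub>C v) \<le> norm c * norm v" for c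
    by (simp add: norm_scaleC)
qed (simp add: scaleC_add_left)

lemma has_field_derivative_on_line:
  fixes x v :: "'a::complex_hilbert_space"
  assumes f: "(f has_derivative D) (at (x + c *\<^sub>C v))"
    and D: "\<And>c v. D (c *\<^sub>C v) = c * D v"
  shows "((\<lambda>c. f (x + c *\<^sub>C v)) has_field_derivative D v) (at c)"
proof -
  have "((\<lambda>c. x + c *\<^sub>C v) has_derivative (\<lambda>c. c *\<^sub>C v)) (at c)"
    by (auto intro!: derivative_eq_intros
        bounded_linear_imp_has_derivative[OF bounded_linear_scaleC_left])
  from has_derivative_compose[OF this f] show ?thesis
    by (simp add: has_field_derivative_def D mult.commute[of _ "D v"])
qed

section \<open>Pseudohyperbolic distance and discs in the ball\<close>

lemma pseudohyperbolic_dist_commute: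
  "pseudohyperbolic_dist x y = pseudohyperbolic_dist y (x::'a::complex_hilbert_space)"
proof -
  have "cmod (1 - cinner x y) = cmod (cnj (1 - cinner y x))"
    using cinner_commute[of x y] by simp
  also have "\<dots> = cmod (1 - cinner y x)"
    by (rule complex_mod_cnj)
  finally show ?thesis
    by (simp add: pseudohyperbolic_dist_def mult.commute)
qed

text \<open>
  In terms of the displacement \<open>v = y - x\<close> the numerator of \<open>\<rho>\<^sup>2\<close> splits into the
  component of \<open>v\<close> along \<open>x\<close> and the whole of \<open>v\<close>, the latter with the smaller weight
  \<open>1 - \<parallel>x\<parallel>\<^sup>2\<close>. The denominator vanishes nowhere, since otherwise the same splitting would equate a
  sum of squares with \<open>- (1 - \<parallel>x\<parallel>\<^sup>2) (1 - \<parallel>y\<parallel>\<^sup>2)\<close>.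
\<close>

lemma pseudohyperbolic_dist_displacement:
  fixes x v :: "'a::complex_hilbert_space"
  assumes x: "norm x < 1" and y: "norm (x + v) < 1"
  defines "d \<equiv> 1 - (norm x)\<^sup>2" and "r \<equiv> pseudohyperbolic_dist x (x + v)"
  shows "0 \<le> r"
    and "(cmod (cinner v x))\<^sup>2 + d * (norm v)\<^sup>2 = (r * cmod (of_real d - cinner v x))\<^sup>2"
proof -
  define s where "s = cinner v x"
  define e where "e = 1 - (norm (x + v))\<^sup>2"
  have d: "d > 0" and e: "e > 0"
    using x y by (simp_all add: d_def e_def power_less_one_iff abs_square_less_1)
  have e_eq: "e = d - 2 * Re s - (norm v)\<^sup>2"
    by (simp add: e_def d_def s_def norm_add_squared)
  have split: "(cmod (of_real d - s))\<^sup>2 - d * e = (cmod s)\<^sup>2 + d * (norm v)\<^sup>2"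
    unfolding e_eq cmod_power2 by (simp add: power2_eq_square algebra_simps)
  have nz: "(cmod (of_real d - s))\<^sup>2 > 0"
  proof -
    have "(cmod s)\<^sup>2 + d * (norm v)\<^sup>2 \<ge> 0" "d * e > 0"
      using d e by auto
    then show ?thesis using split by linarith
  qed
  have inner: "1 - cinner (x + v) x = of_real d - s"
    by (simp add: cinner_add_left cinner_self d_def s_def)
  have "r = pseudohyperbolic_dist (x + v) x"
    unfolding r_def by (rule pseudohyperbolic_dist_commute)
  then have r: "r = sqrt (1 - d * e / (cmod (of_real d - s))\<^sup>2)"
    unfolding pseudohyperbolic_dist_def inner by (simp only: d_def e_def mult.commute)
  have q: "1 - d * e / (cmod (of_real d - s))\<^sup>2
      = ((cmod s)\<^sup>2 + d * (norm v)\<^sup>2) / (cmod (of_real d - s))\<^sup>2"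
    using nz by (simp add: split[symmetric] diff_divide_distrib)
  have nn: "0 \<le> ((cmod s)\<^sup>2 + d * (norm v)\<^sup>2) / (cmod (of_real d - s))\<^sup>2"
    using d by (intro divide_nonneg_nonneg add_nonneg_nonneg) auto
  show "0 \<le> r"
    unfolding r q using nn by simp
  have "r\<^sup>2 = ((cmod s)\<^sup>2 + d * (norm v)\<^sup>2) / (cmod (of_real d - s))\<^sup>2"
    unfolding r q using nn by simp
  then show "(cmod (cinner v x))\<^sup>2 + d * (norm v)\<^sup>2 = (r * cmod (of_real d - cinner v x))\<^sup>2"
    using nz by (simp add: power_mult_distrib s_def)
qed

text \<open>
  The displacement is at most of order \<open>\<rho> (1 - \<parallel>x\<parallel>\<^sup>2)\<close> along \<open>x\<close>, but may be of the larger order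
  \<open>\<rho> (1 - \<parallel>x\<parallel>\<^sup>2)\<^sup>1\<^sup>/\<^sup>2\<close> across it.
\<close>

lemma displacement_bounds:
  fixes x v :: "'a::complex_hilbert_space"
  assumes x: "norm x < 1" and y: "norm (x + v) < 1"
  defines "d \<equiv> 1 - (norm x)\<^sup>2" and "r \<equiv> pseudohyperbolic_dist x (x + v)"
  assumes r: "r \<le> 1 / 2"
  shows "cmod (cinner v x) \<le> 2 * r * d" and "(norm v)\<^sup>2 \<le> 4 * r\<^sup>2 * d"
proof -
  define s where "s = cmod (cinner v x)"
  have d: "d > 0"
    using x by (simp add: d_def power_less_one_iff abs_square_less_1)
  have r0: "0 \<le> r"
    and eq: "s\<^sup>2 + d * (norm v)\<^sup>2 = (r * cmod (of_real d - cinner v x))\<^sup>2"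
    using pseudohyperbolic_dist_displacement[OF x y] by (simp_all add: d_def r_def s_def)
  have tri: "cmod (of_real d - cinner v x) \<le> d + s"
    using norm_triangle_ineq4[of "of_real d" "cinner v x"] d by (simp add: s_def)
  have le: "s\<^sup>2 + d * (norm v)\<^sup>2 \<le> (r * (d + s))\<^sup>2"
    unfolding eq using r0 tri by (intro power_mono mult_left_mono) auto
  have "s\<^sup>2 \<le> (r * (d + s))\<^sup>2"
    using order_trans[OF _ le, of "s\<^sup>2"] d by simp
  then have s1: "s \<le> r * (d + s)"
    by (rule power2_le_imp_le) (use r0 d in \<open>simp add: s_def\<close>)
  have "r * s \<le> s / 2"
    using mult_right_mono[OF r, of s] by (simp add: s_def)
  then have "s / 2 \<le> r * d"
    using s1 by (simp add: algebra_simps)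
  then show s2: "cmod (cinner v x) \<le> 2 * r * d"
    by (simp add: s_def)
  have "r * d \<le> d / 2"
    using mult_right_mono[OF r, of d] d by simp
  then have "d + s \<le> 2 * d"
    using s2 by (simp add: s_def)
  then have "(r * (d + s))\<^sup>2 \<le> (r * (2 * d))\<^sup>2"
    using r0 d by (intro power_mono mult_left_mono) (auto simp: s_def)
  also have "(r * (2 * d))\<^sup>2 = d * (4 * r\<^sup>2 * d)"
    by (simp add: power2_eq_square)
  finally have "d * (norm v)\<^sup>2 \<le> d * (4 * r\<^sup>2 * d)"
    using le zero_le_power2[of s] by linarith
  then show "(norm v)\<^sup>2 \<le> 4 * r\<^sup>2 * d"
    using d by simp
qed

text \<open>
  Both kinds of displacement perturb \<open>1 - \<parallel>\<sqdot>\<parallel>\<^sup>2\<close> by the same order, because the one across \<open>x\<close>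
  enters only quadratically.
\<close>

lemma weight_perturbation:
  fixes x v :: "'a::complex_hilbert_space"
  assumes x: "norm x < 1" and y: "norm (x + v) < 1"
  defines "d \<equiv> 1 - (norm x)\<^sup>2" and "r \<equiv> pseudohyperbolic_dist x (x + v)"
  assumes r: "r \<le> 1 / 2"
  shows "\<bar>(1 - (norm (x + c *\<^sub>C v))\<^sup>2) - d\<bar> \<le> (4 * (cmod c * r) + 4 * (cmod c * r)\<^sup>2) * d"
proof -
  have "\<bar>Re (cinner (c *\<^sub>C v) x)\<bar> \<le> cmod c * cmod (cinner v x)"
    using abs_Re_le_cmod[of "cinner (c *\<^sub>C v) x"] by (simp add: cinner_scaleC_left norm_mult)
  also have "\<dots> \<le> cmod c * (2 * r * d)"
    using displacement_bounds(1)[OF x y] r by (intro mult_left_mono) (auto simp: r_def d_def)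
  finally have 1: "\<bar>Re (cinner (c *\<^sub>C v) x)\<bar> \<le> 2 * (cmod c * r) * d"
    by (simp add: algebra_simps)
  have "(norm (c *\<^sub>C v))\<^sup>2 \<le> (cmod c)\<^sup>2 * (4 * r\<^sup>2 * d)"
    unfolding norm_scaleC power_mult_distrib
    using displacement_bounds(2)[OF x y] r by (intro mult_left_mono) (auto simp: r_def d_def)
  then have 2: "(norm (c *\<^sub>C v))\<^sup>2 \<le> 4 * (cmod c * r)\<^sup>2 * d"
    by (simp add: power_mult_distrib algebra_simps)
  have "(1 - (norm (x + c *\<^sub>C v))\<^sup>2) - d = - 2 * Re (cinner (c *\<^sub>C v) x) - (norm (c *\<^sub>C v))\<^sup>2"
    by (simp add: d_def norm_add_squared)
  then have "\<bar>(1 - (norm (x + c *\<^sub>C v))\<^sup>2) - d\<bar>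
      \<le> 2 * \<bar>Re (cinner (c *\<^sub>C v) x)\<bar> + (norm (c *\<^sub>C v))\<^sup>2"
    by (smt (verit) zero_le_power2)
  also have "\<dots> \<le> 2 * (2 * (cmod c * r) * d) + 4 * (cmod c * r)\<^sup>2 * d"
    using 1 2 by linarith
  finally show ?thesis
    by (simp add: algebra_simps)
qed

section \<open>Lipschitz estimate under a growth bound\<close>

lemma holomorphic_bounded_difference:
  fixes G :: "complex \<Rightarrow> complex"
  assumes G: "G holomorphic_on ball 0 R" and R: "2 < R"
    and B: "\<And>z. z \<in> ball 0 R \<Longrightarrow> cmod (G z) \<le> B"
  shows "cmod (G 1 - G 0) \<le> 2 * B / R"
proof -
  have "cmod (deriv G z) \<le> 2 * B / R" if z: "z \<in> cball 0 1" for z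
  proof -
    have sub: "cball z (R / 2) \<subseteq> ball 0 R"
      using z R by (simp add: cball_subset_ball_iff)
    have hol: "G holomorphic_on cball z (R / 2)"
      using G sub by (rule holomorphic_on_subset)
    have "cmod ((deriv ^^ 1) G z) \<le> fact 1 * B / (R / 2) ^ 1"
    proof (rule Cauchy_inequality)
      show "G holomorphic_on ball z (R / 2)"
        using hol by (rule holomorphic_on_subset) auto
      show "continuous_on (cball z (R / 2)) G"
        using hol by (rule holomorphic_on_imp_continuous_on)
      show "cmod (G w) \<le> B" if "cmod (z - w) = R / 2" for w
        using that sub by (intro B) (auto simp: dist_norm subset_eq)
    qed (use R in auto)
    then show ?thesis by (simp add: mult.commute)
  qed
  moreover have "(G has_field_derivative deriv G z) (at z within cball 0 1)"
    if "z \<in> cball 0 1" for z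
    using that R by (intro has_field_derivative_at_within[OF holomorphic_derivI[OF G]]) auto
  ultimately have "cmod (G 1 - G 0) \<le> 2 * B / R * cmod (1 - 0)"
    by (intro field_differentiable_bound[of "cball 0 1"]) auto
  then show ?thesis by simp
qed

text \<open>
  On the disc of radius \<open>1 / (8 \<rho>)\<close> the weight \<open>1 - \<parallel>x + c (y - x)\<parallel>\<^sup>2\<close> is at least a quarter of
  \<open>1 - \<parallel>x\<parallel>\<^sup>2\<close>, so the Cauchy estimate gives the bound for small \<open>\<rho>\<close>. For large \<open>\<rho>\<close> there
  is nothing to prove, both values being bounded by \<open>M\<close>.
\<close>

lemma weighted_growth_lipschitz:
  fixes g :: "'a::complex_hilbert_space \<Rightarrow> complex"
  assumes hol: "\<And>x v. (\<lambda>c. g (x + c *\<^sub>C v)) holomorphic_on {c. norm (x + c *\<^sub>C v) < 1}"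
    and growth: "\<And>x. norm x < 1 \<Longrightarrow> (1 - (norm x)\<^sup>2) * cmod (g x) \<le> M"
    and x: "norm x < 1" and y: "norm y < 1"
  shows "cmod (of_real (1 - (norm x)\<^sup>2) * g x - of_real (1 - (norm y)\<^sup>2) * g y)
    \<le> 84 * M * pseudohyperbolic_dist x y"
proof -
  define r where "r = pseudohyperbolic_dist x y"
  define d where "d = 1 - (norm x)\<^sup>2"
  define e where "e = 1 - (norm y)\<^sup>2"
  define v where "v = y - x"
  have y_eq: "y = x + v" and yv: "norm (x + v) < 1"
    using y by (simp_all add: v_def)
  have d: "d > 0" and e: "e > 0"
    using x y by (simp_all add: d_def e_def abs_square_less_1)
  have Mx: "d * cmod (g x) \<le> M" and My: "e * cmod (g y) \<le> M"
    using growth[OF x] growth[OF y] by (simp_all add: d_def e_def)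
  have M: "0 \<le> M"
    using Mx d by (smt (verit) norm_ge_zero mult_nonneg_nonneg)
  have r0: "0 \<le> r"
    using pseudohyperbolic_dist_displacement(1)[OF x yv] by (simp add: r_def y_eq)
  have "cmod (of_real d * g x - of_real e * g y) \<le> 84 * M * r"
  proof -
    consider "v = 0" | "1 / 16 \<le> r" | "v \<noteq> 0" "r < 1 / 16"
      by linarith
    then show ?thesis
    proof cases
      case 1
      then show ?thesis
        using M r0 by (simp add: d_def e_def y_eq)
    next
      case 2
      have "cmod (of_real d * g x - of_real e * g y) \<le> d * cmod (g x) + e * cmod (g y)"
        using norm_triangle_ineq4[of "of_real d * g x" "of_real e * g y"] d e
        by (simp add: norm_mult)
      also have "\<dots> \<le> 2 * M"
        using Mx My by simp
      also have "\<dots> \<le> 84 * M * r"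
        using mult_left_mono[OF 2 M] M by linarith
      finally show ?thesis .
    next
      case 3
      have rpos: "0 < r"
      proof -
        have "(norm v)\<^sup>2 \<le> 4 * r\<^sup>2 * d"
          using displacement_bounds(2)[OF x yv] 3 by (simp add: r_def d_def y_eq)
        then show ?thesis
          using 3 r0 by (cases "r = 0") auto
      qed
      \<comment> \<open>\<open>r < 1 / 16\<close> is what makes \<open>R\<close> exceed 2, as the Cauchy estimate requires.\<close>
      define R where "R = 1 / (8 * r)"
      have R: "2 < R"
        using 3 rpos by (simp add: R_def field_simps)
      have perturb: "\<bar>(1 - (norm (x + c *\<^sub>C v))\<^sup>2) - d\<bar>
          \<le> (4 * (cmod c * r) + 4 * (cmod c * r)\<^sup>2) * d" for c
        using weight_perturbation[OF x yv, of c] 3 by (simp add: r_def d_def y_eq)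
      \<comment> \<open>With \<open>\<bar>c\<bar> r \<le> 1 / 8\<close> the relative perturbation is at most \<open>1 / 2 + 1 / 16 < 3 / 4\<close>.\<close>
      have weight: "d / 4 \<le> 1 - (norm (x + c *\<^sub>C v))\<^sup>2" if c: "c \<in> ball 0 R" for c
      proof -
        have cr: "cmod c * r \<le> 1 / 8"
          using c rpos by (simp add: R_def field_simps)
        moreover have "(cmod c * r)\<^sup>2 \<le> (1 / 8)\<^sup>2"
          using cr rpos by (intro power_mono) auto
        ultimately have "4 * (cmod c * r) + 4 * (cmod c * r)\<^sup>2 \<le> 3 / 4"
          by (simp add: power2_eq_square)
        from mult_right_mono[OF this, of d] perturb[of c] d show ?thesis
          by linarith
      qed
      have inside: "norm (x + c *\<^sub>C v) < 1" if "c \<in> ball 0 R" for c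
        using weight[OF that] d abs_square_less_1[of "norm (x + c *\<^sub>C v)"] by simp
      have bound: "cmod (g (x + c *\<^sub>C v)) \<le> 4 * M / d" if c: "c \<in> ball 0 R" for c
      proof -
        have "d / 4 * cmod (g (x + c *\<^sub>C v)) \<le> M"
          using mult_right_mono[OF weight[OF c], of "cmod (g (x + c *\<^sub>C v))"]
            growth[OF inside[OF c]] by simp
        then show ?thesis
          using d by (simp add: field_simps)
      qed
      have line: "x + 1 *\<^sub>C v = y" "x + 0 *\<^sub>C v = x"
        using scaleR_scaleC[of 0 v] by (simp_all add: scaleC_one y_eq)
      have "cmod (g (x + 1 *\<^sub>C v) - g (x + 0 *\<^sub>C v)) \<le> 2 * (4 * M / d) / R"
        by (rule holomorphic_bounded_difference[where G = "\<lambda>c. g (x + c *\<^sub>C v)", OF _ R bound])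
          (use inside in \<open>auto intro!: holomorphic_on_subset[OF hol]\<close>)
      then have diff: "d * cmod (g x - g y) \<le> 64 * M * r"
        using d rpos by (simp add: line R_def norm_minus_commute field_simps)
      have "r\<^sup>2 \<le> 1 / 4 * r"
        using 3 rpos by (simp add: power2_eq_square)
      then have "(4 * r + 4 * r\<^sup>2) * d \<le> 5 * r * d"
        using d by (intro mult_right_mono) auto
      then have de: "\<bar>d - e\<bar> \<le> 5 * r * d"
        using perturb[of 1] by (simp add: line e_def)
      have gy: "d * cmod (g y) \<le> 4 * M"
        using bound[of 1] R d by (simp add: line field_simps)
      \<comment> \<open>The variation of \<open>g\<close> contributes 64 and that of the weight 20 to the constant 84.\<close>
      have "of_real d * g x - of_real e * g y = of_real d * (g x - g y) + of_real (d - e) * g y"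
        by (simp add: algebra_simps)
      then have "cmod (of_real d * g x - of_real e * g y)
          \<le> d * cmod (g x - g y) + \<bar>d - e\<bar> * cmod (g y)"
        using norm_triangle_ineq[of "of_real d * (g x - g y)" "of_real (d - e) * g y"] d
        by (simp add: norm_mult del: of_real_diff)
      also have "\<dots> \<le> 64 * M * r + 5 * r * d * cmod (g y)"
        using diff de by (intro add_mono mult_right_mono) auto
      also have "\<dots> \<le> 64 * M * r + 5 * r * (4 * M)"
        using mult_left_mono[OF gy, of "5 * r"] rpos by (simp add: mult.assoc)
      finally show ?thesis
        by simp
    qed
  qed
  then show ?thesis
    by (simp add: d_def e_def r_def)
qed

section \<open>Bloch functions\<close>

lemma holomorphic_on_ball_derivative:
  assumes f: "holomorphic_on_ball f" and x: "norm x < 1"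
  shows "(f has_derivative frechet_derivative f (at x)) (at x)"
    and "frechet_derivative f (at x) (c *\<^sub>C v) = c * frechet_derivative f (at x) v"
proof -
  obtain D where D: "(f has_derivative D) (at x)" "\<And>c v. D (c *\<^sub>C v) = c * D v"
    using f x unfolding holomorphic_on_ball_def by (metis mem_ball_0)
  moreover have "D = frechet_derivative f (at x)"
    using D(1) by (rule frechet_derivative_at)
  ultimately show "(f has_derivative frechet_derivative f (at x)) (at x)"
    "frechet_derivative f (at x) (c *\<^sub>C v) = c * frechet_derivative f (at x) v"
    by auto
qed

lemma holomorphic_on_line:
  assumes f: "holomorphic_on_ball f"
  shows "(\<lambda>c. f (x + c *\<^sub>C v)) holomorphic_on {c. norm (x + c *\<^sub>C v) < 1}"
  unfolding holomorphic_on_def field_differentiable_def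
  using has_field_derivative_at_within[OF
      has_field_derivative_on_line[OF holomorphic_on_ball_derivative[OF f]]]
  by blast

definition dilation_quotient ::
  "complex \<Rightarrow> ('a::complex_hilbert_space \<Rightarrow> complex) \<Rightarrow> 'a \<Rightarrow> complex"
  where "dilation_quotient c f x = (f (c *\<^sub>C x) - f x) / (c - 1)"

lemma dilation_quotient_holomorphic_on_line:
  assumes f: "holomorphic_on_ball f" and c: "cmod c < 1"
  shows "(\<lambda>z. dilation_quotient c f (x + z *\<^sub>C v)) holomorphic_on {z. norm (x + z *\<^sub>C v) < 1}"
proof -
  have eq: "c *\<^sub>C (x + z *\<^sub>C v) = c *\<^sub>C x + z *\<^sub>C (c *\<^sub>C v)" for z
    by (simp add: scaleC_add_right scaleC_scaleC mult.commute)
  have "norm (c *\<^sub>C x + z *\<^sub>C (c *\<^sub>C v)) < 1" if "norm (x + z *\<^sub>C v) < 1" for z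
    using that c unfolding eq[symmetric] norm_scaleC
    by (smt (verit) mult_left_le_one_le norm_ge_zero)
  then have "(\<lambda>z. f (c *\<^sub>C (x + z *\<^sub>C v))) holomorphic_on {z. norm (x + z *\<^sub>C v) < 1}"
    unfolding eq by (intro holomorphic_on_subset[OF holomorphic_on_line[OF f]]) auto
  moreover have "c - 1 \<noteq> 0"
    using c by auto
  ultimately show ?thesis
    unfolding dilation_quotient_def
    by (intro holomorphic_intros holomorphic_on_line[OF f])
qed

text \<open>
  The segment from \<open>c x\<close> to \<open>x\<close> lies in the ball of radius \<open>\<parallel>x\<parallel>\<close>, where the gradient is at most
  \<open>M / (1 - \<parallel>x\<parallel>\<^sup>2)\<close>; hence the quotient inherits the constant \<open>M\<close> unchanged.
\<close>

lemma dilation_quotient_growth: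
  fixes x :: "'a::complex_hilbert_space"
  assumes f: "holomorphic_on_ball f"
    and M: "\<And>x. norm x < 1 \<Longrightarrow> (1 - (norm x)\<^sup>2) * onorm (frechet_derivative f (at x)) \<le> M"
    and c: "cmod c < 1" and x: "norm x < 1"
  shows "(1 - (norm x)\<^sup>2) * cmod (dilation_quotient c f x) \<le> M"
proof -
  define d where "d = 1 - (norm x)\<^sup>2"
  have d: "d > 0"
    using x by (simp add: d_def abs_square_less_1)
  have c1: "cmod (c - 1) > 0"
    using c by auto
  have "cmod (f (c *\<^sub>C x) - f x) \<le> M / d * norm (c *\<^sub>C x - x)"
  proof (rule differentiable_bound)
    show "convex (cball (0::'a) (norm x))"
      by (rule convex_cball)
    show "(f has_derivative frechet_derivative f (at z)) (at z within cball 0 (norm x))"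
      if "z \<in> cball 0 (norm x)" for z
      using that x
      by (intro has_derivative_at_withinI[OF holomorphic_on_ball_derivative(1)[OF f]]) auto
    show "onorm (frechet_derivative f (at z)) \<le> M / d" if "z \<in> cball 0 (norm x)" for z
    proof -
      have z: "norm z \<le> norm x" "norm z < 1"
        using that x by auto
      have "d \<le> 1 - (norm z)\<^sup>2"
        using power_mono[OF z(1), of 2] by (simp add: d_def)
      moreover have "0 \<le> onorm (frechet_derivative f (at z))"
        using has_derivative_bounded_linear[OF holomorphic_on_ball_derivative(1)[OF f z(2)]]
        by (rule onorm_pos_le)
      ultimately have "d * onorm (frechet_derivative f (at z)) \<le> M"
        using M[OF z(2)] by (meson mult_right_mono order_trans)
      then show ?thesis
        using d by (simp add: field_simps)
    qed
    show "c *\<^sub>C x \<in> cball 0 (norm x)"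
      using c by (simp add: norm_scaleC mult_left_le_one_le)
  qed auto
  also have "c *\<^sub>C x - x = (c - 1) *\<^sub>C x"
    using scaleC_add_left[of "c - 1" 1 x] by (simp add: scaleC_one)
  also have "M / d * norm ((c - 1) *\<^sub>C x) \<le> M / d * cmod (c - 1)"
  proof -
    have "0 \<le> d * onorm (frechet_derivative f (at x))"
      using d has_derivative_bounded_linear[OF holomorphic_on_ball_derivative(1)[OF f x]]
      by (simp add: onorm_pos_le)
    then have "0 \<le> M"
      using M[OF x] by (simp add: d_def)
    then show ?thesis
      unfolding norm_scaleC using d x by (intro mult_left_mono mult_right_le_one_le) auto
  qed
  finally show ?thesis
    using d c1 unfolding dilation_quotient_def d_def[symmetric]
    by (simp add: norm_divide field_simps)
qed

lemma dilation_quotient_tendsto: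
  assumes f: "holomorphic_on_ball f" and x: "norm x < 1"
  shows "((\<lambda>c. dilation_quotient c f x) \<longlongrightarrow> radial_derivative f x) (at 1 within ball 0 1)"
proof -
  have "((\<lambda>c. f (0 + c *\<^sub>C x)) has_field_derivative frechet_derivative f (at x) x) (at 1)"
    by (rule has_field_derivative_on_line)
      (simp_all add: scaleC_one holomorphic_on_ball_derivative[OF f x])
  then have "((\<lambda>c. f (0 + c *\<^sub>C x)) has_field_derivative frechet_derivative f (at x) x)
      (at 1 within ball 0 1)"
    by (rule has_field_derivative_at_within)
  then show ?thesis
    by (simp add: has_field_derivative_iff dilation_quotient_def radial_derivative_def scaleC_one)
qed

lemma bloch_radial_derivative_lipschitz:
  fixes f :: "'a::complex_hilbert_space \<Rightarrow> complex"
  assumes "f \<in> bloch_space"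
  obtains L where "L > 0"
    and "\<And>x y. norm x < 1 \<Longrightarrow> norm y < 1 \<Longrightarrow>
      cmod (of_real (1 - (norm x)\<^sup>2) * radial_derivative f x
        - of_real (1 - (norm y)\<^sup>2) * radial_derivative f y) \<le> L * pseudohyperbolic_dist x y"
proof -
  have f: "holomorphic_on_ball f"
    using assms by (simp add: bloch_space_def)
  obtain M0 where M0: "\<forall>x\<in>ball 0 1.
      (1 - (norm x)\<^sup>2) * onorm (frechet_derivative f (at x)) \<le> M0"
    using assms unfolding bloch_space_def bdd_above_def by blast
  \<comment> \<open>The maximum makes the Lipschitz constant positive when the Bloch seminorm is zero.\<close>
  define M where "M = max M0 1"
  have M: "(1 - (norm x)\<^sup>2) * onorm (frechet_derivative f (at x)) \<le> M" if "norm x < 1" for x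
    using bspec[OF M0, of x] that by (simp add: M_def)
  show thesis
  proof (rule that[of "84 * M"])
    show "84 * M > 0"
      by (simp add: M_def)
    fix x y :: 'a
    assume x: "norm x < 1" and y: "norm y < 1"
    define F where "F g = cmod (of_real (1 - (norm x)\<^sup>2) * g x - of_real (1 - (norm y)\<^sup>2) * g y)"
      for g :: "'a \<Rightarrow> complex"
    have "((\<lambda>c. F (dilation_quotient c f)) \<longlongrightarrow> F (radial_derivative f)) (at 1 within ball 0 1)"
      unfolding F_def by (intro tendsto_intros dilation_quotient_tendsto f x y)
    moreover have "\<forall>\<^sub>F c in at 1 within ball 0 1.
        F (dilation_quotient c f) \<le> 84 * M * pseudohyperbolic_dist x y"
      unfolding F_def eventually_at_filter
      by (intro always_eventually allI impI weighted_growth_lipschitz x y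
          dilation_quotient_holomorphic_on_line[OF f] dilation_quotient_growth[OF f M]) auto
    moreover have "at 1 within ball 0 1 \<noteq> (bot :: complex filter)"
      unfolding trivial_limit_within by (simp add: islimpt_ball)
    ultimately show "F (radial_derivative f) \<le> 84 * M * pseudohyperbolic_dist x y"
      using tendsto_upperbound by blast
  qed
qed

section \<open>Separation\<close>

text \<open>
  Joining \<open>k\<close> to \<open>p k\<close> whenever \<open>p k < k\<close> makes the naturals a forest, whose roots are the \<open>k\<close>
  with \<open>p k \<ge> k\<close>. The labels are its proper two-colouring by 0 and 1 with all roots labelled 0.
\<close>

function alternating_label :: "(nat \<Rightarrow> nat) \<Rightarrow> nat \<Rightarrow> complex" where
  "alternating_label p k = (if p k < k then 1 - alternating_label p (p k) else 0)"
  by auto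
termination
  by (relation "inv_image less_than snd") auto

declare alternating_label.simps [simp del]

lemma alternating_label_range: "alternating_label p k \<in> {0, 1}"
proof (induction k rule: less_induct)
  case (less k)
  then show ?case
    by (cases "p k < k") (auto simp: alternating_label.simps[of p k])
qed

lemma alternating_label_distance:
  assumes "p k < k"
  shows "cmod (alternating_label p k - alternating_label p (p k)) = 1"
  using alternating_label_range[of p "p k"] assms
  by (auto simp: alternating_label.simps[of p k])

theorem proposition3p6:
  fixes x :: "nat \<Rightarrow> 'a::complex_hilbert_space"
  assumes "interpolating_for_bloch x"
  shows "\<exists>C>0. \<forall>k j. k \<noteq> j \<longrightarrow> pseudohyperbolic_dist (x k) (x j) \<ge> C"
proof -
  let ?\<rho> = "\<lambda>k j. pseudohyperbolic_dist (x k) (x j)"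
  have ball: "norm (x n) < 1" for n
    using assms by (auto simp: interpolating_for_bloch_def)
  define p where "p k = arg_min_on (?\<rho> k) {..<k}" for k
  have p: "p k < k \<and> ?\<rho> k (p k) \<le> ?\<rho> k j" if "j < k" for k j
    using that arg_min_if_finite(1)[of "{..<k}" "?\<rho> k"] arg_min_least[of "{..<k}" j "?\<rho> k"]
    by (auto simp: p_def)
  have "range (alternating_label p) \<subseteq> {0, 1}"
    by (rule image_subsetI) (rule alternating_label_range)
  then have "bounded (range (alternating_label p))"
    by (rule bounded_subset[rotated]) simp
  then obtain f where f: "f \<in> bloch_space"
    and a: "\<And>n. of_real (1 - (norm (x n))\<^sup>2) * radial_derivative f (x n) = alternating_label p n"
    using assms unfolding interpolating_for_bloch_def by blast
  obtain L where L: "L > 0"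
    and lip: "\<And>x y. norm x < 1 \<Longrightarrow> norm y < 1 \<Longrightarrow>
      cmod (of_real (1 - (norm x)\<^sup>2) * radial_derivative f x
        - of_real (1 - (norm y)\<^sup>2) * radial_derivative f y) \<le> L * pseudohyperbolic_dist x y"
    using bloch_radial_derivative_lipschitz[OF f] by blast
  have less: "1 / L \<le> ?\<rho> k j" if "j < k" for k j
  proof -
    have "1 \<le> L * ?\<rho> k (p k)"
      using lip[OF ball ball, of k "p k"] p[OF that] alternating_label_distance[of p k]
      unfolding a by simp
    also have "\<dots> \<le> L * ?\<rho> k j"
      using p[OF that] L by simp
    finally show ?thesis
      using L by (simp add: field_simps)
  qed
  have "1 / L \<le> ?\<rho> k j" if "k \<noteq> j" for k j
  proof (cases "j < k")
    case True
    then show ?thesis by (rule less)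
  next
    case False
    then show ?thesis
      using that less[of k j] pseudohyperbolic_dist_commute[of "x k" "x j"] by simp
  qed
  then show ?thesis
    using L by (intro exI[of _ "1 / L"]) auto
qed

end
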